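(* Let $N\ge1$, let $\gamma_1,\gamma_2,V_1,V_2,\theta,\delta>0$ satisfy $\frac{V_1V_2}{\delta\gamma_1\gamma_2}>1+\frac{\theta}{\delta}$, and let $a_{i,j}=a_{j,i}\ge0$ for $i,j=1,\dots,N$. Consider the system on the state space $\mathcal B^N$, $$\dot x_{1,i}=-\gamma_1x_{1,i}+V_1x_{2,i}+\sum_{j=1}^Na_{i,j}(x_{1,j}-x_{1,i}),\qquad \dot x_{2,i}=-\gamma_2x_{2,i}+V_2g(x_{1,i}),\qquad i=1,\dots,N,$$ where $$g(x)=\begin{cases}0,&x<\theta,\\ (x-\theta)/\delta,&\theta\le x\le\theta+\delta,\\ 1,&x>\theta+\delta.\end{cases}$$ If an equilibrium exists in a saturated domain, it is unique (in that domain) and locally asymptotically stable. Furthermore, if $\frac{V_1V_2}{\gamma_1\gamma_2\delta}>N$, then the equilibria in the interior of non-saturated domains are unstable.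
   Context: The state space is $\mathcal B^N=\prod_{i=1}^N\mathcal B$, where $\mathcal B=[0,\bar x_1]\times[0,\bar x_2]$ with $\bar x_1,\bar x_2>0$ is a box that is forward invariant for the uncoupled compartment $\dot x_1=-\gamma_1x_1+V_1x_2$, $\dot x_2=-\gamma_2x_2+V_2g(x_1)$; the $i$-th factor contains $(x_{1,i},x_{2,i})$. For $\alpha\in\{-1,0,1\}^N$ the domain $\Omega_\alpha$ is the set of $x\in\mathcal B^N$ such that, for every $j$: $x_{1,j}>\theta+\delta$ if $\alpha_j=1$; $x_{1,j}<\theta$ if $\alpha_j=-1$; $\theta\le x_{1,j}\le\theta+\delta$ if $\alpha_j=0$. The domain is called saturated if $\alpha_j\in\{-1,1\}$ for all $j$, linear if $\alpha_j=0$ for all $j$, and mixed otherwise; the non-saturated domains are the linear and mixed ones. Stability is in the sense of Lyapunov, and stability and interior are understood relative to the state space $\mathcal B^N$. *)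

theory Defs
  imports "HOL-Analysis.Analysis"
begin

definition solves :: "('a::real_normed_vector \<Rightarrow> 'a) \<Rightarrow> real set \<Rightarrow> (real \<Rightarrow> 'a) \<Rightarrow> bool" where
  "solves f I x \<longleftrightarrow> (\<forall>t\<in>I. (x has_vector_derivative f (x t)) (at t within I))"

definition forward_invariant :: "('a::real_normed_vector \<Rightarrow> 'a) \<Rightarrow> 'a set \<Rightarrow> bool" where
  "forward_invariant f S \<longleftrightarrow>
     (\<forall>T x. solves f {0..T} x \<and> x 0 \<in> S \<longrightarrow> x ` {0..T} \<subseteq> S)"

definition equilibrium :: "('a::real_normed_vector \<Rightarrow> 'a) \<Rightarrow> 'a set \<Rightarrow> 'a \<Rightarrow> bool" where
  "equilibrium f S p \<longleftrightarrow> p \<in> S \<and> f p = 0"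

text \<open>Stability is relative to the state space \<open>S\<close>: only trajectories inside \<open>S\<close> are considered.
  The time horizon \<open>T\<close> is arbitrary, so that the bound holds along every forward
  trajectory for as long as that trajectory is defined.\<close>

definition lyapunov_stable :: "('a::real_normed_vector \<Rightarrow> 'a) \<Rightarrow> 'a set \<Rightarrow> 'a \<Rightarrow> bool" where
  "lyapunov_stable f S p \<longleftrightarrow>
     (\<forall>e>0. \<exists>d>0. \<forall>T x. solves f {0..T} x \<and> x ` {0..T} \<subseteq> S \<and> dist (x 0) p < d \<longrightarrow>
        (\<forall>t\<in>{0..T}. dist (x t) p < e))"

definition locally_attractive :: "('a::real_normed_vector \<Rightarrow> 'a) \<Rightarrow> 'a set \<Rightarrow> 'a \<Rightarrow> bool" where
  "locally_attractive f S p \<longleftrightarrow>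
     (\<exists>d>0. \<forall>x. solves f {0..} x \<and> x ` {0..} \<subseteq> S \<and> dist (x 0) p < d \<longrightarrow> (x \<longlongrightarrow> p) at_top)"

definition locally_asymptotically_stable ::
    "('a::real_normed_vector \<Rightarrow> 'a) \<Rightarrow> 'a set \<Rightarrow> 'a \<Rightarrow> bool" where
  "locally_asymptotically_stable f S p \<longleftrightarrow> lyapunov_stable f S p \<and> locally_attractive f S p"

definition activation :: "real \<Rightarrow> real \<Rightarrow> real \<Rightarrow> real" where
  "activation \<theta> \<delta> x =
     (if x < \<theta> then 0 else if x \<le> \<theta> + \<delta> then (x - \<theta>) / \<delta> else 1)"

definition compartment ::
    "real \<Rightarrow> real \<Rightarrow> real \<Rightarrow> real \<Rightarrow> real \<Rightarrow> real \<Rightarrow> real \<times> real \<Rightarrow> real \<times> real" where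
  "compartment \<gamma>1 \<gamma>2 V1 V2 \<theta> \<delta> x =
     (- \<gamma>1 * fst x + V1 * snd x, - \<gamma>2 * snd x + V2 * activation \<theta> \<delta> (fst x))"

text \<open>A network state \<open>x\<close> has \<open>x $ i = (x\<^sub>1\<^sub>,\<^sub>i, x\<^sub>2\<^sub>,\<^sub>i)\<close>; the number of compartments is \<open>CARD('n)\<close>.\<close>

definition network ::
    "real \<Rightarrow> real \<Rightarrow> real \<Rightarrow> real \<Rightarrow> real \<Rightarrow> real \<Rightarrow> ('n::finite \<Rightarrow> 'n \<Rightarrow> real) \<Rightarrow>
     (real \<times> real) ^ 'n \<Rightarrow> (real \<times> real) ^ 'n" where
  "network \<gamma>1 \<gamma>2 V1 V2 \<theta> \<delta> a x =
     (\<chi> i. (- \<gamma>1 * fst (x $ i) + V1 * snd (x $ i) + (\<Sum>j\<in>UNIV. a i j * (fst (x $ j) - fst (x $ i))),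
           - \<gamma>2 * snd (x $ i) + V2 * activation \<theta> \<delta> (fst (x $ i))))"

definition state_box :: "real \<Rightarrow> real \<Rightarrow> (real \<times> real) set" where
  "state_box b1 b2 = {0..b1} \<times> {0..b2}"

definition state_space :: "real \<Rightarrow> real \<Rightarrow> ((real \<times> real) ^ 'n::finite) set" where
  "state_space b1 b2 = {x. \<forall>i. x $ i \<in> state_box b1 b2}"

definition dom_indices :: "('n \<Rightarrow> int) set" where
  "dom_indices = {\<alpha>. \<forall>j. \<alpha> j \<in> {-1, 0, 1}}"

definition regime :: "real \<Rightarrow> real \<Rightarrow> real \<Rightarrow> real \<Rightarrow> ('n::finite \<Rightarrow> int) \<Rightarrow> ((real \<times> real) ^ 'n) set" where
  "regime b1 b2 \<theta> \<delta> \<alpha> =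
     {x \<in> state_space b1 b2. \<forall>j.
        (\<alpha> j = 1 \<longrightarrow> fst (x $ j) > \<theta> + \<delta>) \<and>
        (\<alpha> j = -1 \<longrightarrow> fst (x $ j) < \<theta>) \<and>
        (\<alpha> j = 0 \<longrightarrow> \<theta> \<le> fst (x $ j) \<and> fst (x $ j) \<le> \<theta> + \<delta>)}"

definition saturated_index :: "('n \<Rightarrow> int) \<Rightarrow> bool" where
  "saturated_index \<alpha> \<longleftrightarrow> (\<forall>j. \<alpha> j \<in> {-1, 1})"

definition linear_index :: "('n \<Rightarrow> int) \<Rightarrow> bool" where
  "linear_index \<alpha> \<longleftrightarrow> (\<forall>j. \<alpha> j = 0)"

definition mixed_index :: "('n \<Rightarrow> int) \<Rightarrow> bool" where
  "mixed_index \<alpha> \<longleftrightarrow> \<not> saturated_index \<alpha> \<and> \<not> linear_index \<alpha>"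

end

theory Submission
  imports Defs
begin

text \<open>
The network is piecewise affine: inside a domain the activation has constant slope in each cell, and
the deviation from an equilibrium obeys a linear system. The coupling enters the equations of the
first components as the negative of a graph Laplacian, by symmetry of the weights.

In a saturated domain all slopes vanish, and the second components decay on their own. The Laplacian
only adds dissipation, so the linear system has no kernel, which gives uniqueness, and a weighted sum
of squares is a strict Lyapunov function (\<open>locally_constant_activation_imp_stable\<close>).

In the interior of a non-saturated domain some cell is linear. Rescaling the second components makes
the linearisation symmetric on the linear cells, and its largest eigenvalue becomes the maximum of
a Rayleigh quotient. The vector with all first components equal to one and second components
\<open>k i / \<gamma>2\<close>, where \<open>k i\<close> is the gain of cell \<open>i\<close>, is not affected by the coupling; its quotient is
positive once \<open>V1 * V2 / (\<gamma>1 * \<gamma>2 * \<delta>)\<close> exceeds the number of cells, since one linear cell has to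
outweigh the decay \<open>\<gamma>1\<close> of all. The off-diagonal entries are nonnegative, so the maximum is attained
at a nonnegative eigenvector (\<open>nonnegative_growing_mode\<close>).

Instability is relative to the state space, so the growing trajectory has to stay in the box even if
the equilibrium lies on its boundary. Invariance of the box for a single compartment prevents the
field from pointing outwards at the corner \<open>(b1, b2)\<close>; for this a trajectory from the corner is needed,
which Picard iteration provides. A maximum principle then shows that a cell with first component
\<open>b1\<close> sits at the corner and is coupled only to cells with first component \<open>b1\<close>, so the eigenvector
may be made to point inwards in all these cells and remain an eigenvector.
\<close>

section \<open>Trajectories and invariant sets\<close>

text \<open>Picard iteration. On a horizon \<open>T\<close> with \<open>L * T \<le> 1/2\<close> the integral operator is a contraction, and
its fixed point solves the equation. To stay within bounded continuous functions on the whole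
line, the upper limit of integration is clamped to \<open>[0, T]\<close>.\<close>
lemma local_solution_exists:
  fixes f :: "'a::banach \<Rightarrow> 'a"
  assumes lip: "L-lipschitz_on UNIV f"
  obtains T x where "T > 0" "x 0 = p" "solves f {0..T} x"
proof -
  have L: "L \<ge> 0" using lip by (rule lipschitz_on_nonneg)
  define T where "T = 1 / (2 * (L + 1))"
  have T: "T > 0" and LT: "L * T \<le> 1/2"
    using L by (auto simp: T_def field_simps)
  define h where "h t = max 0 (min T t)" for t :: real
  have h: "h t \<in> {0..T}" for t using T by (auto simp: h_def)
  have hcont: "continuous_on UNIV h" unfolding h_def by (intro continuous_intros)
  have fcont: "continuous_on U f" for U
    using lipschitz_on_continuous_on[OF lip] continuous_on_subset by blast
  have fx: "continuous_on U (\<lambda>s. f (apply_bcontfun x s))" for U and x :: "real \<Rightarrow>\<^sub>C 'a"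
    using continuous_on_compose2[OF fcont[of UNIV], of U "apply_bcontfun x"] by simp
  define F where "F x t = p + integral {0..h t} (\<lambda>s. f (apply_bcontfun x s))"
    for x :: "real \<Rightarrow>\<^sub>C 'a" and t
  have F: "F x \<in> bcontfun" for x
  proof -
    define G where "G u = p + integral {0..u} (\<lambda>s. f (apply_bcontfun x s))" for u
    have G: "continuous_on {0..T} G" unfolding G_def
      by (intro continuous_intros indefinite_integral_continuous_1 integrable_continuous_real fx)
    have "continuous_on UNIV (\<lambda>t. G (h t))"
      by (rule continuous_on_compose2[OF G hcont]) (use h in auto)
    moreover have "bounded (range (\<lambda>t. G (h t)))"
      by (rule bounded_subset[OF compact_imp_bounded[OF compact_continuous_image[OF G]]])
         (use h in auto)
    ultimately show ?thesis by (simp add: bcontfun_def F_def G_def)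
  qed
  have "dist (Bcontfun (F x)) (Bcontfun (F y)) \<le> 1/2 * dist x y" for x y
  proof (rule dist_bound)
    fix t
    have "dist (F x t) (F y t) =
        norm (integral {0..h t} (\<lambda>s. f (apply_bcontfun x s) - f (apply_bcontfun y s)))"
      by (simp add: F_def dist_norm integral_diff integrable_continuous_real fx)
    also have "\<dots> \<le> L * dist x y * (h t - 0)"
    proof (rule integral_bound)
      fix s
      have "norm (f (apply_bcontfun x s) - f (apply_bcontfun y s))
          \<le> L * dist (apply_bcontfun x s) (apply_bcontfun y s)"
        using lipschitz_onD[OF lip, of "apply_bcontfun x s" "apply_bcontfun y s"]
        by (simp add: dist_norm)
      also have "\<dots> \<le> L * dist x y" by (intro mult_left_mono dist_bounded L)
      finally show "norm (f (apply_bcontfun x s) - f (apply_bcontfun y s)) \<le> L * dist x y" .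
    qed (use h[of t] in \<open>auto intro!: continuous_intros fx\<close>)
    also have "\<dots> \<le> L * dist x y * T" using h[of t] L by (intro mult_left_mono) auto
    also have "\<dots> = (L * T) * dist x y" by simp
    also have "\<dots> \<le> 1/2 * dist x y" by (intro mult_right_mono LT) simp
    finally show "dist (apply_bcontfun (Bcontfun (F x)) t) (apply_bcontfun (Bcontfun (F y)) t)
        \<le> 1/2 * dist x y" by (simp add: Bcontfun_inverse F)
  qed
  then obtain x where "Bcontfun (F x) = x"
    using banach_fix_type[of "1/2" "\<lambda>x. Bcontfun (F x)"] by auto
  then have x: "apply_bcontfun x t = F x t" for t by (metis Bcontfun_inverse F)
  have xT: "apply_bcontfun x t = p + integral {0..t} (\<lambda>s. f (apply_bcontfun x s))"
    if "t \<in> {0..T}" for t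
    using x[of t] that by (simp add: F_def h_def)
  show thesis
  proof (rule that[OF T])
    show "apply_bcontfun x 0 = p" using xT[of 0] T by simp
    show "solves f {0..T} (apply_bcontfun x)" unfolding solves_def
    proof
      fix t assume t: "t \<in> {0..T}"
      have "((\<lambda>t. p + integral {0..t} (\<lambda>s. f (apply_bcontfun x s))) has_vector_derivative
          0 + f (apply_bcontfun x t)) (at t within {0..T})"
        by (intro has_vector_derivative_add has_vector_derivative_const
            integral_has_vector_derivative[OF fx t])
      then show "(apply_bcontfun x has_vector_derivative f (apply_bcontfun x t)) (at t within {0..T})"
        using has_vector_derivative_transform[OF t xT] by simp
    qed
  qed
qed

lemma solves_subset: "solves f J x \<Longrightarrow> I \<subseteq> J \<Longrightarrow> solves f I x"
  unfolding solves_def by (blast intro: has_vector_derivative_within_subset)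

text \<open>Invariance speaks about trajectories only, so a condition on the field at \<open>p\<close> needs an actual
trajectory from \<open>p\<close>: were \<open>l (f p)\<close> positive, \<open>l\<close> would grow along it past its maximum on \<open>S\<close>.\<close>
lemma forward_invariant_imp_no_outflow:
  fixes f :: "'a::banach \<Rightarrow> 'a" and l :: "'a \<Rightarrow> real"
  assumes inv: "forward_invariant f S" and lip: "L-lipschitz_on UNIV f"
    and l: "bounded_linear l" and p: "p \<in> S" and max: "\<And>q. q \<in> S \<Longrightarrow> l q \<le> l p"
  shows "l (f p) \<le> 0"
proof (rule ccontr)
  assume "\<not> l (f p) \<le> 0"
  then have pos: "l (f p) > 0" by simp
  obtain T x where T: "T > 0" and x: "x 0 = p" "solves f {0..T} x"
    using local_solution_exists[OF lip] by metis
  have "(x has_vector_derivative f (x 0)) (at 0 within {0..T})"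
    using x(2) T by (simp add: solves_def)
  then have "((\<lambda>t. l (x t)) has_vector_derivative l (f p)) (at 0 within {0..T})"
    using bounded_linear.has_vector_derivative[OF l] x(1) by auto
  then have "((\<lambda>t. l (x t)) has_real_derivative l (f p)) (at 0 within {0..T})"
    by (simp add: has_real_derivative_iff_has_vector_derivative)
  from has_real_derivative_pos_inc_right[OF this pos] obtain d
    where d: "d > 0" "\<And>s. s > 0 \<Longrightarrow> s \<in> {0..T} \<Longrightarrow> s < d \<Longrightarrow> l p < l (x s)"
    using x(1) by auto
  define s where "s = min T (d/2)"
  have s: "s > 0" "s \<in> {0..T}" "s < d" using T d(1) by (auto simp: s_def)
  have "x s \<in> S" using inv x p s(2) unfolding forward_invariant_def by blast
  with max[of "x s"] d(2)[OF s] show False by simp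
qed

section \<open>Criteria for stability and instability\<close>

text \<open>The differential inequality is available only below the level \<open>\<rho>\<close>. It never stops being available:
at the first time at which \<open>w\<close> reached \<open>\<rho>\<close>, the inequality would have held all along, so that
\<open>w \<le> w 0 < \<rho>\<close> there.\<close>
lemma exponential_decay:
  fixes w :: "real \<Rightarrow> real"
  assumes der: "\<And>t. t \<in> {0..T} \<Longrightarrow> (w has_real_derivative w' t) (at t within {0..T})"
    and decay: "\<And>t. t \<in> {0..T} \<Longrightarrow> w t < \<rho> \<Longrightarrow> w' t \<le> - m * w t"
    and nonneg: "\<And>t. t \<in> {0..T} \<Longrightarrow> w t \<ge> 0"
    and m: "m \<ge> 0" and init: "w 0 < \<rho>" and t: "t \<in> {0..T}"
  shows "w t \<le> w 0 * exp (- m * t)"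
proof -
  have cont: "continuous_on {0..T} w"
    using der by (meson DERIV_continuous continuous_on_eq_continuous_within)
  have *: "w s \<le> w 0 * exp (- m * s)"
    if s: "s \<in> {0..T}" and below: "\<And>r. 0 \<le> r \<Longrightarrow> r < s \<Longrightarrow> w r < \<rho>" for s
  proof -
    have "exp (m * s) * w s \<le> exp (m * 0) * w 0"
    proof (rule DERIV_nonpos_imp_decreasing_open[where f = "\<lambda>t. exp (m * t) * w t"])
      show "0 \<le> s" using s by simp
      show "continuous_on {0..s} (\<lambda>t. exp (m * t) * w t)"
        using s by (intro continuous_intros continuous_on_subset[OF cont]) auto
      fix r assume r: "0 < r" "r < s"
      then have rT: "r \<in> {0..T}" "r \<in> {0<..<T}" using s by auto
      have "(w has_real_derivative w' r) (at r)"
        using der[OF rT(1)] at_within_interior[of r "{0..T}"] rT(2)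
        by (metis interior_atLeastAtMost_real)
      then have "((\<lambda>t. exp (m * t) * w t) has_real_derivative exp (m * r) * (m * w r + w' r)) (at r)"
        by (auto intro!: derivative_eq_intros simp: algebra_simps)
      moreover have "exp (m * r) * (m * w r + w' r) \<le> 0"
        using decay[OF rT(1)] below[of r] r by (intro mult_nonneg_nonpos) auto
      ultimately show "\<exists>y. ((\<lambda>t. exp (m * t) * w t) has_real_derivative y) (at r) \<and> y \<le> 0" by blast
    qed
    then show ?thesis by (simp add: exp_minus field_simps)
  qed
  have below: "w s < \<rho>" if s: "s \<in> {0..T}" for s
  proof (rule ccontr)
    assume "\<not> w s < \<rho>"
    define A where "A = {r \<in> {0..T}. w r \<in> {\<rho>..}}"
    have "A \<noteq> {}" using s \<open>\<not> w s < \<rho>\<close> by (auto simp: A_def)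
    moreover have "closed A"
      unfolding A_def using continuous_closed_preimage[OF cont closed_atLeastAtMost closed_atLeast[of \<rho>]]
      by (simp add: vimage_def Int_def)
    moreover have bdd: "bdd_below A" by (rule bdd_belowI[of _ 0]) (auto simp: A_def)
    ultimately have in_A: "Inf A \<in> A" using closed_contains_Inf by blast
    have "w r < \<rho>" if "0 \<le> r" "r < Inf A" for r
      using that in_A cInf_lower[OF _ bdd, of r] by (force simp: A_def)
    then have "w (Inf A) \<le> w 0 * exp (- m * Inf A)" using in_A * by (auto simp: A_def)
    also have "\<dots> \<le> w 0"
      using in_A m nonneg[of 0] mult_left_mono[of "exp (- m * Inf A)" 1 "w 0"] by (auto simp: A_def)
    finally show False using in_A init by (auto simp: A_def)
  qed
  show ?thesis using *[OF t] below t by auto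
qed

text \<open>The sublevel set of \<open>W\<close> at height \<open>c * r\<^sup>2\<close> lies in the ball where \<open>W\<close> decays, which is what
\<open>exponential_decay\<close> needs to keep a trajectory there for good. The quadratic bounds then turn decay
of \<open>W\<close> into decay of the distance.\<close>
lemma strict_lyapunov_function_imp_stable:
  fixes f :: "'a::real_normed_vector \<Rightarrow> 'a" and W :: "'a \<Rightarrow> real"
  assumes c: "c > 0" "\<And>x. c * (dist x p)\<^sup>2 \<le> W x"
    and C: "\<And>x. W x \<le> C * (dist x p)\<^sup>2"
    and der: "\<And>x. (W has_derivative W' x) (at x)"
    and m: "m > 0" and r: "r > 0"
    and decay: "\<And>x. dist x p < r \<Longrightarrow> W' x (f x) \<le> - m * W x"
  shows "locally_asymptotically_stable f S p"
proof -
  have along: "c * (dist (x t) p)\<^sup>2 \<le> W (x 0) * exp (- m * t)"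
    if x: "solves f {0..T} x" and t: "t \<in> {0..T}" and init: "W (x 0) < c * r\<^sup>2" for T t x
  proof -
    have "W (x t) \<le> W (x 0) * exp (- m * t)"
    proof (rule exponential_decay[where w = "\<lambda>t. W (x t)" and w' = "\<lambda>t. W' (x t) (f (x t))"
          and \<rho> = "c * r\<^sup>2", OF _ _ _ _ init t])
      fix s assume s: "s \<in> {0..T}"
      have "(x has_vector_derivative f (x s)) (at s within {0..T})"
        using x s by (simp add: solves_def)
      from vector_derivative_diff_chain_within[OF this has_derivative_at_withinI[OF der]]
      show "((\<lambda>t. W (x t)) has_real_derivative W' (x s) (f (x s))) (at s within {0..T})"
        by (simp add: has_real_derivative_iff_has_vector_derivative o_def)
      show "W (x s) \<ge> 0" using c(2)[of "x s"] c(1) by (meson order_trans mult_nonneg_nonneg less_imp_le zero_le_power2)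
      assume "W (x s) < c * r\<^sup>2"
      then have "c * (dist (x s) p)\<^sup>2 < c * r\<^sup>2" using c(2)[of "x s"] by linarith
      then have "dist (x s) p < r"
        using c(1) r by (simp add: power_less_imp_less_base)
      then show "W' (x s) (f (x s)) \<le> - m * W (x s)" by (rule decay)
    qed (use m in simp)
    then show ?thesis using c(2)[of "x t"] by linarith
  qed
  define C' where "C' = max C 1"
  have C': "C' > 0" "W x \<le> C' * (dist x p)\<^sup>2" for x
    using C[of x] mult_right_mono[of C C' "(dist x p)\<^sup>2"] by (auto simp: C'_def)
  have small: "\<exists>d>0. \<forall>x. dist x p < d \<longrightarrow> W x < \<epsilon>" if "\<epsilon> > 0" for \<epsilon>
  proof (intro exI[of _ "sqrt (\<epsilon> / C')"] conjI allI impI)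
    show "sqrt (\<epsilon> / C') > 0" using that C'(1) by simp
    fix x assume "dist x p < sqrt (\<epsilon> / C')"
    then have "(dist x p)\<^sup>2 < \<epsilon> / C'" 
      using real_less_rsqrt that C'(1)
      by (metis real_sqrt_less_iff real_sqrt_unique zero_le_dist)
    then show "W x < \<epsilon>" using C'(2)[of x] C'(1) by (simp add: field_simps)
  qed
  have stable: "lyapunov_stable f S p" unfolding lyapunov_stable_def
  proof (intro allI impI)
    fix e :: real assume e: "e > 0"
    then have "c * (min e r)\<^sup>2 > 0" using c(1) r by simp
    from small[OF this] obtain d where d: "d > 0" "\<And>x. dist x p < d \<Longrightarrow> W x < c * (min e r)\<^sup>2" by blast
    show "\<exists>d>0. \<forall>T x. solves f {0..T} x \<and> x ` {0..T} \<subseteq> S \<and> dist (x 0) p < d \<longrightarrow>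
        (\<forall>t\<in>{0..T}. dist (x t) p < e)"
    proof (intro exI[of _ d] conjI allI impI ballI d(1))
      fix T x t assume x: "solves f {0..T} x \<and> x ` {0..T} \<subseteq> S \<and> dist (x 0) p < d" and t: "t \<in> {0..T}"
      have W0: "W (x 0) < c * (min e r)\<^sup>2" using d(2) x by blast
      have "c * (min e r)\<^sup>2 \<le> c * r\<^sup>2" using c(1) e r by (intro mult_left_mono power_mono) auto
      then have "c * (dist (x t) p)\<^sup>2 \<le> W (x 0) * exp (- m * t)"
        using W0 x by (intro along[OF _ t]) auto
      also have "\<dots> \<le> W (x 0)"
      proof -
        have "W (x 0) \<ge> 0" using c(2)[of "x 0"] c(1) by (meson order_trans mult_nonneg_nonneg less_imp_le zero_le_power2)
        then show ?thesis using t m mult_left_mono[of "exp (- m * t)" 1 "W (x 0)"] by simp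
      qed
      also have "\<dots> < c * (min e r)\<^sup>2" by (rule W0)
      finally have "(dist (x t) p)\<^sup>2 < (min e r)\<^sup>2" using c(1) by simp
      then have "dist (x t) p < min e r" by (rule power_less_imp_less_base) (use e r in auto)
      then show "dist (x t) p < e" by simp
    qed
  qed
  have attractive: "locally_attractive f S p"
  proof -
    have "c * r\<^sup>2 > 0" using c(1) r by simp
    from small[OF this] obtain d where d: "d > 0" "\<And>x. dist x p < d \<Longrightarrow> W x < c * r\<^sup>2" by blast
    show ?thesis unfolding locally_attractive_def
    proof (intro exI[of _ d] conjI allI impI d(1))
      fix x :: "real \<Rightarrow> 'a" assume x: "solves f {0..} x \<and> x ` {0..} \<subseteq> S \<and> dist (x 0) p < d"
      have bound: "dist (x t) p \<le> sqrt (W (x 0) / c * exp (- m * t))" if "t \<ge> 0" for t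
      proof (rule real_le_rsqrt)
        have "c * (dist (x t) p)\<^sup>2 \<le> W (x 0) * exp (- m * t)"
          using x that by (intro along[where T = t] d(2) solves_subset[where J = "{0..}" and I = "{0..t}"]) auto
        then show "(dist (x t) p)\<^sup>2 \<le> W (x 0) / c * exp (- m * t)" using c(1) by (simp add: field_simps)
      qed
      have "filterlim (\<lambda>t. - m * t) at_bot at_top"
        by (rule filterlim_tendsto_neg_mult_at_bot[OF tendsto_const _ filterlim_ident]) (use m in simp)
      then have "((\<lambda>t. exp (- m * t)) \<longlongrightarrow> 0) at_top"
        by (rule filterlim_compose[OF exp_at_bot])
      from tendsto_real_sqrt[OF tendsto_mult[OF tendsto_const[of "W (x 0) / c"] this]]
      have "((\<lambda>t. sqrt (W (x 0) / c * exp (- m * t))) \<longlongrightarrow> 0) at_top" by simp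
      then have "((\<lambda>t. dist (x t) p) \<longlongrightarrow> 0) at_top"
      proof (rule tendsto_sandwich[OF _ _ tendsto_const, rotated 2])
        show "\<forall>\<^sub>F t in at_top. dist (x t) p \<le> sqrt (W (x 0) / c * exp (- m * t))"
          using eventually_ge_at_top[of 0] by eventually_elim (rule bound)
      qed simp
      then show "(x \<longlongrightarrow> p) at_top" by (rule tendsto_dist_iff[THEN iffD2])
    qed
  qed
  show ?thesis using stable attractive by (simp add: locally_asymptotically_stable_def)
qed

text \<open>On the ray the equation reduces to \<open>\<tau>' = \<mu> * \<tau>\<close>, so \<open>p + (\<epsilon> * exp (\<mu> * t)) *\<^sub>R w\<close> is a trajectory that
travels from arbitrarily near \<open>p\<close> to the fixed distance \<open>e * norm w\<close>.\<close>
lemma invariant_ray_imp_unstable: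
  fixes f :: "'a::real_normed_vector \<Rightarrow> 'a"
  assumes \<mu>: "\<mu> > 0" and w: "w \<noteq> 0" and e: "e > 0"
    and ray: "\<And>\<tau>. 0 < \<tau> \<Longrightarrow> \<tau> \<le> e \<Longrightarrow> p + \<tau> *\<^sub>R w \<in> S \<and> f (p + \<tau> *\<^sub>R w) = (\<mu> * \<tau>) *\<^sub>R w"
  shows "\<not> lyapunov_stable f S p"
proof
  assume "lyapunov_stable f S p"
  moreover have "e * norm w > 0" using e w by simp
  ultimately obtain d where d: "d > 0"
    and stable: "\<And>T x. solves f {0..T} x \<Longrightarrow> x ` {0..T} \<subseteq> S \<Longrightarrow> dist (x 0) p < d \<Longrightarrow>
        (\<forall>t\<in>{0..T}. dist (x t) p < e * norm w)"
    unfolding lyapunov_stable_def by meson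
  define \<epsilon> where "\<epsilon> = min e (d / (2 * norm w))"
  have \<epsilon>: "0 < \<epsilon>" "\<epsilon> \<le> e" "\<epsilon> * norm w < d"
    using e d w by (auto simp: \<epsilon>_def min_def field_simps)
  define T where "T = ln (e / \<epsilon>) / \<mu>"
  have T: "T \<ge> 0" using \<epsilon> \<mu> by (simp add: T_def)
  have expT: "\<epsilon> * exp (\<mu> * T) = e" using \<epsilon>(1) e \<mu> by (simp add: T_def)
  define x where "x t = p + (\<epsilon> * exp (\<mu> * t)) *\<^sub>R w" for t
  have range: "0 < \<epsilon> * exp (\<mu> * t)" "\<epsilon> * exp (\<mu> * t) \<le> e" if "t \<in> {0..T}" for t
  proof -
    show "0 < \<epsilon> * exp (\<mu> * t)" using \<epsilon>(1) by simp
    have "\<epsilon> * exp (\<mu> * t) \<le> \<epsilon> * exp (\<mu> * T)" using that \<mu> \<epsilon>(1) by simp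
    then show "\<epsilon> * exp (\<mu> * t) \<le> e" using expT by simp
  qed
  have "solves f {0..T} x" unfolding solves_def
  proof
    fix t assume t: "t \<in> {0..T}"
    have "((\<lambda>t. \<epsilon> * exp (\<mu> * t)) has_vector_derivative \<mu> * (\<epsilon> * exp (\<mu> * t))) (at t within {0..T})"
      unfolding has_real_derivative_iff_has_vector_derivative[symmetric]
      by (auto intro!: derivative_eq_intros)
    then have "((\<lambda>t. p + (\<epsilon> * exp (\<mu> * t)) *\<^sub>R w) has_vector_derivative
        0 + (\<mu> * (\<epsilon> * exp (\<mu> * t))) *\<^sub>R w) (at t within {0..T})"
      by (intro has_vector_derivative_add has_vector_derivative_const
          bounded_linear.has_vector_derivative[OF bounded_linear_scaleR_left])
    then show "(x has_vector_derivative f (x t)) (at t within {0..T})"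
      using ray[OF range[OF t]] by (simp add: x_def[abs_def])
  qed
  moreover have "x ` {0..T} \<subseteq> S" using ray range by (auto simp: x_def)
  moreover have "dist (x 0) p < d" using \<epsilon> by (simp add: x_def dist_norm)
  ultimately have "dist (x T) p < e * norm w" using stable T by fastforce
  then show False using expT e by (simp add: x_def dist_norm)
qed

section \<open>The largest eigenvalue of a self-adjoint operator\<close>

lemma rayleigh_maximum:
  fixes M :: "'a::euclidean_space \<Rightarrow> 'a" and v0 :: 'a
  assumes M: "linear M" and ne: "v0 \<noteq> 0"
  obtains v where "norm v = 1" "\<And>u. u \<bullet> M u \<le> (v \<bullet> M v) * (u \<bullet> u)"
proof -
  have "continuous_on (sphere 0 1) (\<lambda>v. v \<bullet> M v)"
    by (intro continuous_intros linear_continuous_on linear_conv_bounded_linear[THEN iffD1] M)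
  moreover have "v0 /\<^sub>R norm v0 \<in> sphere 0 1" using ne by simp
  ultimately have "\<exists>v\<in>sphere 0 1. \<forall>u\<in>sphere 0 1. u \<bullet> M u \<le> v \<bullet> M v"
    by (intro continuous_attains_sup) auto
  then obtain v where v: "v \<in> sphere 0 1" "\<And>u. u \<in> sphere 0 1 \<Longrightarrow> u \<bullet> M u \<le> v \<bullet> M v" by blast
  show thesis
  proof (rule that)
    show "norm v = 1" using v(1) by simp
    fix u show "u \<bullet> M u \<le> (v \<bullet> M v) * (u \<bullet> u)"
    proof (cases "u = 0")
      case False
      have "u /\<^sub>R norm u \<in> sphere 0 1" using False by simp
      from v(2)[OF this] have "(u \<bullet> M u) / (norm u)\<^sup>2 \<le> v \<bullet> M v"
        by (simp add: linear_scale[OF M] power2_eq_square divide_inverse mult_ac)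
      then show ?thesis using False by (simp add: pos_divide_le_eq power2_norm_eq_inner)
    qed (simp add: linear_0[OF M])
  qed
qed

text \<open>The form \<open>\<mu> * (u \<bullet> u) - u \<bullet> M u\<close> is nonnegative and vanishes at \<open>v\<close>, hence its gradient
\<open>2 *\<^sub>R (\<mu> *\<^sub>R v - M v)\<close> vanishes there. The proof tests the form along the line through \<open>v\<close> in the
direction \<open>w\<close> of half that gradient.\<close>
lemma rayleigh_maximizer_is_eigenvector:
  fixes M :: "'a::real_inner \<Rightarrow> 'a"
  assumes M: "linear M" and sym: "\<And>u v. u \<bullet> M v = M u \<bullet> v"
    and bound: "\<And>u. u \<bullet> M u \<le> \<mu> * (u \<bullet> u)" and v: "v \<bullet> M v \<ge> \<mu> * (v \<bullet> v)"
  shows "M v = \<mu> *\<^sub>R v"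
proof -
  define w where "w = \<mu> *\<^sub>R v - M v"
  define b where "b = \<mu> * (w \<bullet> w) - w \<bullet> M w"
  have b: "b \<ge> 0" using bound[of w] by (simp add: b_def)
  have vv: "v \<bullet> M v = \<mu> * (v \<bullet> v)" using bound[of v] v by simp
  have Mw: "v \<bullet> M w = w \<bullet> M v" by (metis sym inner_commute)
  have ww: "\<mu> * (w \<bullet> v) - w \<bullet> M v = w \<bullet> w"
    by (simp add: w_def inner_diff_right)
  have parabola: "0 \<le> 2 * t * (w \<bullet> w) + t * t * b" for t
  proof -
    have "\<mu> * ((v + t *\<^sub>R w) \<bullet> (v + t *\<^sub>R w)) - (v + t *\<^sub>R w) \<bullet> M (v + t *\<^sub>R w)
        = (\<mu> * (v \<bullet> v) - v \<bullet> M v) + 2 * t * (\<mu> * (w \<bullet> v) - w \<bullet> M v) + t * t * b"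
      using Mw
      by (simp add: linear_add[OF M] linear_scale[OF M] inner_add_left inner_add_right b_def
          inner_commute[of v w] algebra_simps)
    then show ?thesis using bound[of "v + t *\<^sub>R w"] vv ww by simp
  qed
  have "w \<bullet> w = 0"
  proof (rule ccontr)
    assume "w \<bullet> w \<noteq> 0"
    then have pos: "w \<bullet> w > 0" by simp
    \<comment> \<open>A downhill step that is short compared with the curvature \<open>b\<close>, which may be zero.\<close>
    define t where "t = - (w \<bullet> w) / (b + 1)"
    have "t < 0" using pos b by (simp add: t_def divide_neg_pos)
    have "t * b \<ge> - (w \<bullet> w)" using pos b by (simp add: t_def field_simps)
    then have "2 * (w \<bullet> w) + t * b > 0" using pos by linarith
    with \<open>t < 0\<close> have "t * (2 * (w \<bullet> w) + t * b) < 0" by (rule mult_neg_pos)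
    then show False using parabola[of t] by (simp add: algebra_simps)
  qed
  then show ?thesis by (simp add: w_def)
qed

section \<open>Symmetric coupling and the linearised network\<close>

text \<open>Summation by parts on the weighted graph \<open>a\<close>: symmetric coupling is the negative of a Laplacian.\<close>
lemma laplacian_form:
  fixes u v :: "'n::finite \<Rightarrow> real"
  assumes sym: "\<And>i j. a i j = a j i"
  shows "(\<Sum>i\<in>UNIV. u i * (\<Sum>j\<in>UNIV. a i j * (v j - v i))) =
    - (\<Sum>i\<in>UNIV. \<Sum>j\<in>UNIV. a i j * (u i - u j) * (v i - v j)) / 2"
proof -
  let ?S = "\<Sum>i\<in>UNIV. \<Sum>j\<in>UNIV. a i j * u i * (v j - v i)"
  have "?S = (\<Sum>i\<in>UNIV. \<Sum>j\<in>UNIV. a i j * u j * (v i - v j))"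
    by (subst sum.swap) (simp add: sym)
  then have "2 * ?S = ?S + (\<Sum>i\<in>UNIV. \<Sum>j\<in>UNIV. a i j * u j * (v i - v j))" by simp
  also have "\<dots> = - (\<Sum>i\<in>UNIV. \<Sum>j\<in>UNIV. a i j * (u i - u j) * (v i - v j))"
    unfolding sum.distrib[symmetric] sum_negf[symmetric]
    by (intro sum.cong refl) (simp add: algebra_simps)
  finally have "?S = - (\<Sum>i\<in>UNIV. \<Sum>j\<in>UNIV. a i j * (u i - u j) * (v i - v j)) / 2" by simp
  moreover have "(\<Sum>i\<in>UNIV. u i * (\<Sum>j\<in>UNIV. a i j * (v j - v i))) = ?S"
    by (simp add: sum_distrib_left mult_ac)
  ultimately show ?thesis by simp
qed

lemma laplacian_dissipative:
  fixes u :: "'n::finite \<Rightarrow> real"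
  assumes "\<And>i j. a i j = a j i" "\<And>i j. a i j \<ge> 0"
  shows "(\<Sum>i\<in>UNIV. u i * (\<Sum>j\<in>UNIV. a i j * (u j - u i))) \<le> 0"
  using assms by (simp add: laplacian_form mult.assoc sum_nonneg)

text \<open>The system without its constant term, where \<open>s i\<close> stands for \<open>V2\<close> times the slope of the activation
in cell \<open>i\<close>.\<close>
definition linearised ::
    "real \<Rightarrow> real \<Rightarrow> real \<Rightarrow> ('n \<Rightarrow> real) \<Rightarrow> ('n::finite \<Rightarrow> 'n \<Rightarrow> real) \<Rightarrow>
     (real \<times> real) ^ 'n \<Rightarrow> (real \<times> real) ^ 'n" where
  "linearised \<gamma>1 \<gamma>2 V1 s a u =
     (\<chi> i. (- \<gamma>1 * fst (u $ i) + V1 * snd (u $ i) + (\<Sum>j\<in>UNIV. a i j * (fst (u $ j) - fst (u $ i))),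
           - \<gamma>2 * snd (u $ i) + s i * fst (u $ i)))"

lemma network_eq_linearised:
  assumes "\<And>i. V2 * (activation \<theta> \<delta> (fst (x $ i)) - activation \<theta> \<delta> (fst (p $ i)))
      = s i * (fst (x $ i) - fst (p $ i))"
  shows "network \<gamma>1 \<gamma>2 V1 V2 \<theta> \<delta> a x =
    network \<gamma>1 \<gamma>2 V1 V2 \<theta> \<delta> a p + linearised \<gamma>1 \<gamma>2 V1 s a (x - p)"
proof -
  have "(\<Sum>j\<in>UNIV. a i j * (fst (x $ j) - fst (x $ i))) = 
    (\<Sum>j\<in>UNIV. a i j * (fst (p $ j) - fst (p $ i))) + 
    (\<Sum>j\<in>UNIV. a i j * (fst (x $ j) - fst (p $ j) - (fst (x $ i) - fst (p $ i))))" for i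
    unfolding sum.distrib[symmetric] by (intro sum.cong refl) (simp add: algebra_simps)
  then show ?thesis using assms
    by (simp add: network_def linearised_def vec_eq_iff prod_eq_iff algebra_simps)
qed

lemma dist_squared_cells:
  fixes x p :: "(real \<times> real) ^ 'n::finite"
  shows "(dist x p)\<^sup>2 = (\<Sum>i\<in>UNIV. (fst (x $ i) - fst (p $ i))\<^sup>2 + (snd (x $ i) - snd (p $ i))\<^sup>2)"
  by (simp add: dist_vec_def L2_set_def sum_nonneg dist_prod_def dist_real_def)

section \<open>Saturated equilibria\<close>

text \<open>With zero slopes the second components decouple and vanish. Pairing the first components with
themselves leaves \<open>\<gamma>1\<close> times a sum of squares, balanced by a coupling term of the opposite sign.\<close>
lemma saturated_linearisation_injective:
  fixes u :: "(real \<times> real) ^ 'n::finite"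
  assumes \<gamma>: "\<gamma>1 > 0" "\<gamma>2 > 0" and a: "\<And>i j. a i j = a j i" "\<And>i j. a i j \<ge> 0"
    and eq: "linearised \<gamma>1 \<gamma>2 V1 (\<lambda>_. 0) a u = 0"
  shows "u = 0"
proof -
  have z: "snd (u $ i) = 0" for i
    using eq \<gamma>(2) by (simp add: linearised_def vec_eq_iff prod_eq_iff)
  have "\<gamma>1 * fst (u $ i) = (\<Sum>j\<in>UNIV. a i j * (fst (u $ j) - fst (u $ i)))" for i
    using eq z by (simp add: linearised_def vec_eq_iff prod_eq_iff algebra_simps)
  then have "(\<Sum>i\<in>UNIV. fst (u $ i) * (\<gamma>1 * fst (u $ i))) \<le> 0"
    using laplacian_dissipative[OF a, of "\<lambda>i. fst (u $ i)"] by simp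
  moreover have "fst (u $ i) * (\<gamma>1 * fst (u $ i)) \<ge> 0" for i
    using \<gamma>(1) by (simp add: mult.left_commute[of _ \<gamma>1])
  ultimately have "fst (u $ i) * (\<gamma>1 * fst (u $ i)) = 0" for i
    using sum_nonneg_eq_0_iff[of UNIV "\<lambda>i. fst (u $ i) * (\<gamma>1 * fst (u $ i))"] sum_nonneg
    by (metis (no_types, lifting) UNIV_I antisym finite)
  then show ?thesis using z \<gamma>(1) by (simp add: vec_eq_iff prod_eq_iff)
qed

text \<open>Near \<open>p\<close> each cell is the cascade \<open>z' = - \<gamma>2 * z\<close>, \<open>y' = - \<gamma>1 * y + V1 * z\<close>, up to the dissipative coupling.
A weighted sum of squares decays once the weight of \<open>z\<close> is large enough to absorb the cross term.\<close>
lemma locally_constant_activation_imp_stable: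
  fixes p :: "(real \<times> real) ^ 'n::finite"
  assumes pos: "\<gamma>1 > 0" "\<gamma>2 > 0" "V1 > 0" and a: "\<And>i j. a i j = a j i" "\<And>i j. a i j \<ge> 0"
    and eq: "network \<gamma>1 \<gamma>2 V1 V2 \<theta> \<delta> a p = 0"
    and r: "r > 0" and const: "\<And>x i. dist x p < r \<Longrightarrow>
        activation \<theta> \<delta> (fst (x $ i)) = activation \<theta> \<delta> (fst (p $ i))"
  shows "locally_asymptotically_stable (network \<gamma>1 \<gamma>2 V1 V2 \<theta> \<delta> a) S p"
proof -
  \<comment> \<open>This weight makes \<open>\<gamma>1 * y\<^sup>2 - 2 * V1 * y * z + K * \<gamma>2 * z\<^sup>2\<close> a perfect square.\<close>
  define K where "K = V1\<^sup>2 / (\<gamma>1 * \<gamma>2)"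
  have K: "K > 0" using pos by (simp add: K_def)
  define W where "W x = (\<Sum>i\<in>UNIV. (fst (x $ i) - fst (p $ i))\<^sup>2 + K * (snd (x $ i) - snd (p $ i))\<^sup>2)"
    for x :: "(real \<times> real) ^ 'n"
  define W' where "W' x h = (\<Sum>i\<in>UNIV. 2 * (fst (x $ i) - fst (p $ i)) * fst (h $ i)
      + K * (2 * (snd (x $ i) - snd (p $ i)) * snd (h $ i)))" for x h :: "(real \<times> real) ^ 'n"
  show ?thesis
  proof (rule strict_lyapunov_function_imp_stable[where W = W and W' = W'])
    show "min 1 K > 0" using K by simp
    show "max 1 K * (dist x p)\<^sup>2 \<ge> W x" for x
      unfolding dist_squared_cells W_def sum_distrib_left
      by (intro sum_mono) (simp add: distrib_left add_mono mult_right_mono mult_right_mono[of 1 "max 1 K", simplified])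
    show "min 1 K * (dist x p)\<^sup>2 \<le> W x" for x
      unfolding dist_squared_cells W_def sum_distrib_left
      by (intro sum_mono) (simp add: distrib_left add_mono mult_right_mono mult_right_mono[of "min 1 K" 1, simplified])
    show "(W has_derivative W' x) (at x)" for x
      unfolding W_def[abs_def] W'_def[abs_def]
      by (auto intro!: derivative_eq_intros bounded_linear.has_derivative[OF bounded_linear_vec_nth]
          simp: algebra_simps fun_eq_iff)
    show "min \<gamma>1 \<gamma>2 > 0" using pos by simp
    show "r > 0" by (rule r)
    fix x assume x: "dist x p < r"
    define u where "u = x - p"
    define y z where "y i = fst (u $ i)" and "z i = snd (u $ i)" for i
    have f: "network \<gamma>1 \<gamma>2 V1 V2 \<theta> \<delta> a x = linearised \<gamma>1 \<gamma>2 V1 (\<lambda>_. 0) a u"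
      using network_eq_linearised[of V2 \<theta> \<delta> x p "\<lambda>_. 0"] const[OF x] eq by (simp add: u_def)
    have "W' x (network \<gamma>1 \<gamma>2 V1 V2 \<theta> \<delta> a x) =
        (\<Sum>i\<in>UNIV. 2 * (- \<gamma>1 * (y i)\<^sup>2 + V1 * y i * z i - K * \<gamma>2 * (z i)\<^sup>2)
          + 2 * (y i * (\<Sum>j\<in>UNIV. a i j * (y j - y i))))"
      unfolding W'_def f
      by (intro sum.cong refl)
        (simp add: linearised_def y_def z_def u_def power2_eq_square algebra_simps)
    also have "\<dots> = (\<Sum>i\<in>UNIV. 2 * (- \<gamma>1 * (y i)\<^sup>2 + V1 * y i * z i - K * \<gamma>2 * (z i)\<^sup>2))
          + 2 * (\<Sum>i\<in>UNIV. y i * (\<Sum>j\<in>UNIV. a i j * (y j - y i)))"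
      by (simp add: sum.distrib sum_distrib_left)
    also have "\<dots> \<le> (\<Sum>i\<in>UNIV. 2 * (- \<gamma>1 * (y i)\<^sup>2 + V1 * y i * z i - K * \<gamma>2 * (z i)\<^sup>2))"
      using laplacian_dissipative[OF a, of y] by simp
    also have "\<dots> \<le> (\<Sum>i\<in>UNIV. - min \<gamma>1 \<gamma>2 * ((y i)\<^sup>2 + K * (z i)\<^sup>2))"
    proof (rule sum_mono)
      fix i
      have "0 \<le> (\<gamma>1 * y i - V1 * z i)\<^sup>2 / \<gamma>1" using pos by simp
      also have "\<dots> = \<gamma>1 * (y i)\<^sup>2 - 2 * V1 * y i * z i + K * \<gamma>2 * (z i)\<^sup>2"
        using pos by (simp add: K_def power2_eq_square field_simps)
      finally have "2 * (- \<gamma>1 * (y i)\<^sup>2 + V1 * y i * z i - K * \<gamma>2 * (z i)\<^sup>2)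
          \<le> - (\<gamma>1 * (y i)\<^sup>2 + \<gamma>2 * (K * (z i)\<^sup>2))" by (simp add: algebra_simps)
      moreover have "min \<gamma>1 \<gamma>2 * (y i)\<^sup>2 \<le> \<gamma>1 * (y i)\<^sup>2" by (intro mult_right_mono) auto
      moreover have "min \<gamma>1 \<gamma>2 * (K * (z i)\<^sup>2) \<le> \<gamma>2 * (K * (z i)\<^sup>2)"
        using K by (intro mult_right_mono) auto
      ultimately show "2 * (- \<gamma>1 * (y i)\<^sup>2 + V1 * y i * z i - K * \<gamma>2 * (z i)\<^sup>2)
          \<le> - min \<gamma>1 \<gamma>2 * ((y i)\<^sup>2 + K * (z i)\<^sup>2)" by (simp add: algebra_simps)
    qed
    also have "\<dots> = - min \<gamma>1 \<gamma>2 * W x"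
      by (simp add: W_def sum_distrib_left y_def z_def u_def)
    finally show "W' x (network \<gamma>1 \<gamma>2 V1 V2 \<theta> \<delta> a x) \<le> - min \<gamma>1 \<gamma>2 * W x" .
  qed
qed

lemma saturated_activation_locally_constant:
  fixes p :: "(real \<times> real) ^ 'n::finite"
  assumes "\<And>i. fst (p $ i) < \<theta> \<or> fst (p $ i) > \<theta> + \<delta>" "\<delta> > 0"
  obtains r where "r > 0" "\<And>x i. dist x p < r \<Longrightarrow>
      activation \<theta> \<delta> (fst (x $ i)) = activation \<theta> \<delta> (fst (p $ i))"
proof -
  have "\<forall>\<^sub>F x in nhds p. activation \<theta> \<delta> (fst (x $ i)) = activation \<theta> \<delta> (fst (p $ i))" for i
  proof -
    have lim: "((\<lambda>x. fst (x $ i)) \<longlongrightarrow> fst (p $ i)) (nhds p)"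
      by (intro tendsto_intros filterlim_ident)
    show ?thesis
    proof (cases "fst (p $ i) < \<theta>")
      case True
      show ?thesis using order_tendstoD(2)[OF lim True]
        by eventually_elim (use True in \<open>simp add: activation_def\<close>)
    next
      case False
      then have "\<theta> + \<delta> < fst (p $ i)" using assms(1)[of i] by simp
      from order_tendstoD(1)[OF lim this] show ?thesis
        by eventually_elim (use \<open>\<delta> > 0\<close> \<open>\<theta> + \<delta> < fst (p $ i)\<close> in \<open>simp add: activation_def\<close>)
    qed
  qed
  then have "\<forall>\<^sub>F x in nhds p. \<forall>i. activation \<theta> \<delta> (fst (x $ i)) = activation \<theta> \<delta> (fst (p $ i))"
    by (rule eventually_all_finite)
  then show thesis using that unfolding eventually_nhds_metric by blast
qed

section \<open>Growing modes\<close>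

text \<open>Rescaling the second components balances the two off-diagonal gains \<open>V1\<close> and \<open>V2 / \<delta>\<close> of a linear
cell to their geometric mean \<open>k i\<close>. A saturated cell has \<open>k i = 0\<close> in place of the one-sided gain
\<open>V1\<close>; this is harmless for growing modes, in which the second component of such a cell vanishes.\<close>
definition symmetrised ::
    "real \<Rightarrow> real \<Rightarrow> ('n \<Rightarrow> real) \<Rightarrow> ('n::finite \<Rightarrow> 'n \<Rightarrow> real) \<Rightarrow>
     (real \<times> real) ^ 'n \<Rightarrow> (real \<times> real) ^ 'n" where
  "symmetrised \<gamma>1 \<gamma>2 k a u =
     (\<chi> i. (- \<gamma>1 * fst (u $ i) + k i * snd (u $ i) + (\<Sum>j\<in>UNIV. a i j * (fst (u $ j) - fst (u $ i))),
           - \<gamma>2 * snd (u $ i) + k i * fst (u $ i)))"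

lemma linear_symmetrised: "linear (symmetrised \<gamma>1 \<gamma>2 k a)"
proof (rule linearI)
  fix u v :: "(real \<times> real) ^ 'a" and c :: real
  have "(\<Sum>j\<in>UNIV. a i j * (fst (u $ j) + fst (v $ j) - (fst (u $ i) + fst (v $ i)))) = 
    (\<Sum>j\<in>UNIV. a i j * (fst (u $ j) - fst (u $ i))) + (\<Sum>j\<in>UNIV. a i j * (fst (v $ j) - fst (v $ i)))" for i
    unfolding sum.distrib[symmetric] by (intro sum.cong refl) (simp add: algebra_simps)
  then show "symmetrised \<gamma>1 \<gamma>2 k a (u + v) = symmetrised \<gamma>1 \<gamma>2 k a u + symmetrised \<gamma>1 \<gamma>2 k a v"
    by (simp add: symmetrised_def vec_eq_iff algebra_simps)
  have "(\<Sum>j\<in>UNIV. a i j * (c * fst (u $ j) - c * fst (u $ i))) = 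
    c * (\<Sum>j\<in>UNIV. a i j * (fst (u $ j) - fst (u $ i)))" for i
    unfolding sum_distrib_left by (intro sum.cong refl) (simp add: algebra_simps)
  then show "symmetrised \<gamma>1 \<gamma>2 k a (c *\<^sub>R u) = c *\<^sub>R symmetrised \<gamma>1 \<gamma>2 k a u"
    by (simp add: symmetrised_def vec_eq_iff algebra_simps)
qed

lemma symmetrised_form:
  assumes "\<And>i j. a i j = a j i"
  shows "u \<bullet> symmetrised \<gamma>1 \<gamma>2 k a v =
    (\<Sum>i\<in>UNIV. - \<gamma>1 * (fst (u $ i) * fst (v $ i)) - \<gamma>2 * (snd (u $ i) * snd (v $ i))
       + k i * (fst (u $ i) * snd (v $ i) + snd (u $ i) * fst (v $ i)))
    - (\<Sum>i\<in>UNIV. \<Sum>j\<in>UNIV. a i j * (fst (u $ i) - fst (u $ j)) * (fst (v $ i) - fst (v $ j))) / 2"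
proof -
  have "u \<bullet> symmetrised \<gamma>1 \<gamma>2 k a v =
    (\<Sum>i\<in>UNIV. (- \<gamma>1 * (fst (u $ i) * fst (v $ i)) - \<gamma>2 * (snd (u $ i) * snd (v $ i))
       + k i * (fst (u $ i) * snd (v $ i) + snd (u $ i) * fst (v $ i)))
     + fst (u $ i) * (\<Sum>j\<in>UNIV. a i j * (fst (v $ j) - fst (v $ i))))"
    unfolding inner_vec_def
    by (intro sum.cong refl) (simp add: symmetrised_def inner_prod_def algebra_simps)
  then show ?thesis using laplacian_form[OF assms, where u = "\<lambda>i. fst (u $ i)" and v = "\<lambda>i. fst (v $ i)"]
    by (simp add: sum.distrib)
qed

lemma symmetrised_selfadjoint:
  assumes "\<And>i j. a i j = a j i"
  shows "u \<bullet> symmetrised \<gamma>1 \<gamma>2 k a v = symmetrised \<gamma>1 \<gamma>2 k a u \<bullet> v"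
  by (subst inner_commute[of _ v]) (simp add: symmetrised_form[OF assms] algebra_simps)

text \<open>Passing to absolute values brings neighbouring entries closer together and can only increase the
products with nonnegative weight; this is the variational half of the Perron-Frobenius theorem.\<close>
lemma symmetrised_abs_form:
  assumes "\<And>i j. a i j = a j i" "\<And>i j. a i j \<ge> 0" "\<And>i. k i \<ge> 0"
  defines "\<And>u. pos u \<equiv> (\<chi> i. (\<bar>fst (u $ i)\<bar>, \<bar>snd (u $ i)\<bar>)) :: (real \<times> real) ^ 'n::finite"
  shows "u \<bullet> symmetrised \<gamma>1 \<gamma>2 k a u \<le> pos u \<bullet> symmetrised \<gamma>1 \<gamma>2 k a (pos u)"
proof -
  have "a i j * (\<bar>fst (u $ i)\<bar> - \<bar>fst (u $ j)\<bar>) * (\<bar>fst (u $ i)\<bar> - \<bar>fst (u $ j)\<bar>)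
      \<le> a i j * (fst (u $ i) - fst (u $ j)) * (fst (u $ i) - fst (u $ j))" for i j
  proof -
    have "\<bar>\<bar>fst (u $ i)\<bar> - \<bar>fst (u $ j)\<bar>\<bar> \<le> \<bar>fst (u $ i) - fst (u $ j)\<bar>" by linarith
    then have "(\<bar>fst (u $ i)\<bar> - \<bar>fst (u $ j)\<bar>)\<^sup>2 \<le> (fst (u $ i) - fst (u $ j))\<^sup>2"
      by (simp add: abs_le_square_iff)
    then show ?thesis using assms(2)[of i j] by (simp add: power2_eq_square mult.assoc mult_left_mono)
  qed
  moreover have "k i * (fst (u $ i) * snd (u $ i) + snd (u $ i) * fst (u $ i))
      \<le> k i * (\<bar>fst (u $ i)\<bar> * \<bar>snd (u $ i)\<bar> + \<bar>snd (u $ i)\<bar> * \<bar>fst (u $ i)\<bar>)" for i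
    using assms(3)[of i] by (intro mult_left_mono add_mono) (simp_all flip: abs_mult)
  ultimately show ?thesis unfolding symmetrised_form[OF assms(1)] pos_def
    by (intro diff_mono divide_right_mono sum_mono add_mono) (simp_all flip: abs_mult)
qed

text \<open>A maximiser of the Rayleigh quotient can be taken nonnegative by \<open>symmetrised_abs_form\<close>, and it is
an eigenvector. Its eigenvalue is positive because one test vector already gives a positive value;
a vector with constant first components does not see the coupling.\<close>
lemma nonnegative_growing_mode:
  fixes a :: "'n::finite \<Rightarrow> 'n \<Rightarrow> real"
  assumes a: "\<And>i j. a i j = a j i" "\<And>i j. a i j \<ge> 0" and k: "\<And>i. k i \<ge> 0"
    and \<gamma>2: "\<gamma>2 > 0" and gain: "(\<Sum>i\<in>UNIV. (k i)\<^sup>2 / \<gamma>2) > \<gamma>1 * real CARD('n)"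
  obtains \<mu> u where "\<mu> > 0" "u \<noteq> 0" "\<And>i. fst (u $ i) \<ge> 0" "\<And>i. snd (u $ i) \<ge> 0"
    "symmetrised \<gamma>1 \<gamma>2 k a u = \<mu> *\<^sub>R u"
proof -
  let ?M = "symmetrised \<gamma>1 \<gamma>2 k a"
  \<comment> \<open>Given first components one, the second components \<open>k i / \<gamma>2\<close> maximise the form.\<close>
  define t :: "(real \<times> real) ^ 'n" where "t = (\<chi> i. (1, k i / \<gamma>2))"
  have "t \<bullet> ?M t = (\<Sum>i\<in>UNIV. - \<gamma>1 + (k i)\<^sup>2 / \<gamma>2)"
    unfolding symmetrised_form[OF a(1)] t_def using \<gamma>2
    by (simp add: power2_eq_square field_simps)
  also have "\<dots> > 0" using gain by (simp add: sum_subtractf mult.commute)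
  finally have tpos: "t \<bullet> ?M t > 0" .
  then have "t \<noteq> 0" by auto
  from rayleigh_maximum[OF linear_symmetrised this] obtain v
    where v: "norm v = 1" "\<And>u. u \<bullet> ?M u \<le> (v \<bullet> ?M v) * (u \<bullet> u)" by metis
  define \<mu> where "\<mu> = v \<bullet> ?M v"
  define u where "u = (\<chi> i. (\<bar>fst (v $ i)\<bar>, \<bar>snd (v $ i)\<bar>))"
  have uu: "u \<bullet> u = v \<bullet> v" by (simp add: u_def inner_vec_def inner_prod_def)
  have vv: "v \<bullet> v = 1" using v(1) by (simp add: norm_eq_1)
  have "\<mu> * (t \<bullet> t) > 0" using v(2)[of t] tpos by (simp add: \<mu>_def)
  then have "\<mu> > 0" by (metis inner_ge_zero zero_less_mult_pos2 less_eq_real_def mult_zero_right order_less_irrefl)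
  moreover have "u \<noteq> 0" using uu vv by auto
  moreover have "?M u = \<mu> *\<^sub>R u"
  proof (rule rayleigh_maximizer_is_eigenvector[OF linear_symmetrised symmetrised_selfadjoint[OF a(1)]])
    show "w \<bullet> ?M w \<le> \<mu> * (w \<bullet> w)" for w using v(2) by (simp add: \<mu>_def)
    show "\<mu> * (u \<bullet> u) \<le> u \<bullet> ?M u"
      using symmetrised_abs_form[OF a k, of v] uu vv by (simp add: \<mu>_def u_def)
  qed
  ultimately show thesis by (intro that[of \<mu> u]) (simp_all add: u_def)
qed

section \<open>Non-saturated equilibria\<close>

lemma activation_lipschitz:
  assumes "\<delta> > 0"
  shows "(1 / \<delta>)-lipschitz_on UNIV (activation \<theta> \<delta>)"
proof (rule lipschitz_onI)
  fix x y
  have act: "activation \<theta> \<delta> t = max 0 (min 1 ((t - \<theta>) / \<delta>))" for t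
    using assms by (auto simp: activation_def field_simps)
  have "\<bar>activation \<theta> \<delta> x - activation \<theta> \<delta> y\<bar> \<le> \<bar>(x - \<theta>) / \<delta> - (y - \<theta>) / \<delta>\<bar>"
    unfolding act by linarith
  also have "\<dots> = 1 / \<delta> * \<bar>x - y\<bar>"
    using assms by (simp add: abs_divide flip: diff_divide_distrib)
  finally show "dist (activation \<theta> \<delta> x) (activation \<theta> \<delta> y) \<le> 1 / \<delta> * dist x y"
    by (simp add: dist_real_def)
qed (use assms in simp)

lemma compartment_lipschitz:
  assumes "\<delta> > 0"
  obtains L where "L-lipschitz_on UNIV (compartment \<gamma>1 \<gamma>2 V1 V2 \<theta> \<delta>)"
proof -
  have fst: "1-lipschitz_on UNIV (fst :: real \<times> real \<Rightarrow> real)"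
    and snd: "1-lipschitz_on UNIV (snd :: real \<times> real \<Rightarrow> real)"
    by (rule lipschitz_onI; simp add: dist_fst_le dist_snd_le)+
  have act: "(1 / \<delta> * 1)-lipschitz_on UNIV (\<lambda>x :: real \<times> real. activation \<theta> \<delta> (fst x))"
    by (rule lipschitz_on_compose2[OF fst lipschitz_on_subset[OF activation_lipschitz[OF assms]]]) simp
  note lip = lipschitz_on_Pair[OF
      lipschitz_on_add[OF lipschitz_on_cmult_real[OF fst, of "- \<gamma>1"] lipschitz_on_cmult_real[OF snd, of V1]]
      lipschitz_on_add[OF lipschitz_on_cmult_real[OF snd, of "- \<gamma>2"] lipschitz_on_cmult_real[OF act, of V2]]]
  show thesis by (rule that, unfold compartment_def[abs_def], rule lip)
qed

text \<open>At the corner \<open>(b1, b2)\<close> both coordinates are maximal on the box, so neither may increase.\<close>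
lemma invariant_box_corner:
  assumes "forward_invariant (compartment \<gamma>1 \<gamma>2 V1 V2 \<theta> \<delta>) (state_box b1 b2)"
    and "\<delta> > 0" "b1 > 0" "b2 > 0"
  shows "V1 * b2 \<le> \<gamma>1 * b1" "V2 * activation \<theta> \<delta> b1 \<le> \<gamma>2 * b2"
proof -
  obtain L where L: "L-lipschitz_on UNIV (compartment \<gamma>1 \<gamma>2 V1 V2 \<theta> \<delta>)"
    using compartment_lipschitz assms(2) by metis
  have corner: "(b1, b2) \<in> state_box b1 b2" using assms by (simp add: state_box_def)
  have "fst (compartment \<gamma>1 \<gamma>2 V1 V2 \<theta> \<delta> (b1, b2)) \<le> 0"
    by (rule forward_invariant_imp_no_outflow[OF assms(1) L bounded_linear_fst corner])
       (auto simp: state_box_def)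
  then show "V1 * b2 \<le> \<gamma>1 * b1" by (simp add: compartment_def)
  have "snd (compartment \<gamma>1 \<gamma>2 V1 V2 \<theta> \<delta> (b1, b2)) \<le> 0"
    by (rule forward_invariant_imp_no_outflow[OF assms(1) L bounded_linear_snd corner])
       (auto simp: state_box_def)
  then show "V2 * activation \<theta> \<delta> b1 \<le> \<gamma>2 * b2" by (simp add: compartment_def)
qed

text \<open>A maximum principle: in a cell with the largest possible first component, neither the internal rate
nor any coupling term can be positive, and they add up to zero.\<close>
lemma equilibrium_at_upper_face:
  fixes p :: "(real \<times> real) ^ 'n::finite"
  assumes eq: "network \<gamma>1 \<gamma>2 V1 V2 \<theta> \<delta> a p = 0" and p: "p \<in> state_space b1 b2"
    and a: "\<And>i j. a i j \<ge> 0" and V1: "V1 > 0" and corner: "V1 * b2 \<le> \<gamma>1 * b1"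
    and face: "fst (p $ i) = b1"
  shows "snd (p $ i) = b2" "a i j \<noteq> 0 \<Longrightarrow> fst (p $ j) = b1"
proof -
  have box: "fst (p $ j) \<le> b1" "snd (p $ j) \<le> b2" for j
    using p by (auto simp: state_space_def state_box_def mem_Times_iff)
  have flow: "a i j * (b1 - fst (p $ j)) \<ge> 0" for j using a box by simp
  have "- \<gamma>1 * b1 + V1 * snd (p $ i) + (\<Sum>j\<in>UNIV. a i j * (fst (p $ j) - b1)) = 0"
    using arg_cong[OF eq, of "\<lambda>v. fst (v $ i)"] face by (simp add: network_def)
  moreover have "(\<Sum>j\<in>UNIV. a i j * (fst (p $ j) - b1)) = - (\<Sum>j\<in>UNIV. a i j * (b1 - fst (p $ j)))"
    unfolding sum_negf[symmetric] by (intro sum.cong refl) (simp add: algebra_simps)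
  moreover have "V1 * snd (p $ i) \<le> V1 * b2" using box V1 by simp
  moreover have "(\<Sum>j\<in>UNIV. a i j * (b1 - fst (p $ j))) \<ge> 0" by (intro sum_nonneg flow)
  ultimately have sum0: "(\<Sum>j\<in>UNIV. a i j * (b1 - fst (p $ j))) = 0" and "V1 * snd (p $ i) = V1 * b2"
    using corner by linarith+
  then show "snd (p $ i) = b2" using V1 by simp
  have "a i j * (b1 - fst (p $ j)) = 0"
    using sum0 flow sum_nonneg_eq_0_iff[of UNIV "\<lambda>j. a i j * (b1 - fst (p $ j))"] by simp
  then show "a i j \<noteq> 0 \<Longrightarrow> fst (p $ j) = b1" by simp
qed

text \<open>A ray leaves an interval at once only if it starts at an endpoint and points outwards.\<close>
lemma interval_ray:
  fixes c h b :: real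
  assumes "c \<in> {0..b}" "h \<ge> 0 \<and> (c < b \<or> h = 0) \<or> h \<le> 0 \<and> c > 0"
  shows "\<forall>\<^sub>F \<tau> in at_right 0. c + \<tau> * h \<in> {0..b}"
proof -
  have lim: "((\<lambda>\<tau>. c + \<tau> * h) \<longlongrightarrow> c) (at_right 0)"
    by (rule tendsto_eq_intros refl | simp)+
  have pos: "\<forall>\<^sub>F \<tau> in at_right (0 :: real). \<tau> > 0" by (rule eventually_at_right_less)
  consider "h = 0" | "h > 0" "c < b" | "h \<le> 0" "c > 0" using assms(2) by fastforce
  then show ?thesis
  proof cases
    case 1
    then show ?thesis using assms(1) by simp
  next
    case 2
    from pos order_tendstoD(2)[OF lim 2(2)] show ?thesis
      by eventually_elim (use assms(1) 2(1) in auto)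
  next
    case 3
    from pos order_tendstoD(1)[OF lim 3(2)] show ?thesis
      by eventually_elim (use assms(1) 3(1) in \<open>auto simp: mult_nonneg_nonpos intro: add_decreasing2\<close>)
  qed
qed

lemma activation_affine_on_regime:
  assumes "x \<in> regime b1 b2 \<theta> \<delta> \<alpha>" "p \<in> regime b1 b2 \<theta> \<delta> \<alpha>" "\<alpha> \<in> dom_indices" "\<delta> > 0"
  shows "V2 * (activation \<theta> \<delta> (fst (x $ i)) - activation \<theta> \<delta> (fst (p $ i)))
      = (if \<alpha> i = 0 then V2 / \<delta> else 0) * (fst (x $ i) - fst (p $ i))"
proof -
  consider "\<alpha> i = -1" | "\<alpha> i = 0" | "\<alpha> i = 1" using assms(3) by (auto simp: dom_indices_def)
  then show ?thesis
  proof cases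
    case 2
    then have "activation \<theta> \<delta> (fst (x $ i)) = (fst (x $ i) - \<theta>) / \<delta>"
      "activation \<theta> \<delta> (fst (p $ i)) = (fst (p $ i) - \<theta>) / \<delta>"
      using assms by (auto simp: regime_def activation_def)
    then show ?thesis using 2 by (simp add: diff_divide_distrib right_diff_distrib)
  qed (use assms in \<open>auto simp: regime_def activation_def\<close>)
qed

lemma linearised_scaleR: "linearised \<gamma>1 \<gamma>2 V1 s a (c *\<^sub>R u) = c *\<^sub>R linearised \<gamma>1 \<gamma>2 V1 s a u"
proof -
  have "(\<Sum>j\<in>UNIV. a i j * (c * fst (u $ j) - c * fst (u $ i))) =
    c * (\<Sum>j\<in>UNIV. a i j * (fst (u $ j) - fst (u $ i)))" for i
    unfolding sum_distrib_left by (intro sum.cong refl) (simp add: algebra_simps)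
  then show ?thesis by (simp add: linearised_def vec_eq_iff algebra_simps)
qed

text \<open>The growing mode is turned into a ray of states along which the network acts linearly. The ray must
stay in the state space although \<open>p\<close> may lie on its boundary, as happens if \<open>(b1, b2)\<close> is itself the
unstable equilibrium of a compartment. A nonnegative mode respects the lower faces. Where \<open>p\<close> lies on
the upper face of the first component, the sign of the mode is reversed; such cells are coupled only
to cells of the same kind, so the modified vector is still an eigenvector. The upper face of the
second component is harmless elsewhere: a linear cell stays below it, and in a saturated cell the
second component of the mode vanishes.\<close>
lemma nonsaturated_equilibrium_unstable:
  fixes p :: "(real \<times> real) ^ 'n::finite"
  assumes pos: "\<gamma>1 > 0" "\<gamma>2 > 0" "V1 > 0" "V2 > 0" "\<delta> > 0" "b1 > 0" "b2 > 0"
    and a: "\<And>i j. a i j = a j i" "\<And>i j. a i j \<ge> 0"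
    and corner: "V1 * b2 \<le> \<gamma>1 * b1" "V2 * activation \<theta> \<delta> b1 \<le> \<gamma>2 * b2"
    and gain: "V1 * V2 / (\<gamma>1 * \<gamma>2 * \<delta>) > real CARD('n)"
    and \<alpha>: "\<alpha> \<in> dom_indices" "\<alpha> l = 0"
    and p: "p \<in> top_of_set (state_space b1 b2) interior_of regime b1 b2 \<theta> \<delta> \<alpha>"
    and eq: "network \<gamma>1 \<gamma>2 V1 V2 \<theta> \<delta> a p = 0"
  shows "\<not> lyapunov_stable (network \<gamma>1 \<gamma>2 V1 V2 \<theta> \<delta> a) (state_space b1 b2) p"
proof -
  let ?S = "state_space b1 b2 :: ((real \<times> real) ^ 'n) set"
  let ?R = "regime b1 b2 \<theta> \<delta> \<alpha>"
  obtain U where U: "openin (top_of_set ?S) U" "p \<in> U" "U \<subseteq> ?R"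
    using p by (auto simp: interior_of_def)
  then obtain r where r: "r > 0" "\<And>x. x \<in> ?S \<Longrightarrow> dist x p < r \<Longrightarrow> x \<in> ?R"
    unfolding openin_euclidean_subtopology_iff by blast
  have pR: "p \<in> ?R" using U by blast
  then have pS: "p \<in> ?S" by (simp add: regime_def)
  have box: "0 \<le> fst (p $ i)" "fst (p $ i) \<le> b1" "0 \<le> snd (p $ i)" "snd (p $ i) \<le> b2" for i
    using pS by (auto simp: state_space_def state_box_def mem_Times_iff)
  note face = equilibrium_at_upper_face[OF eq pS a(2) pos(3) corner(1)]
  \<comment> \<open>An upward shift of cell \<open>i\<close> stays in the regime, so the cell is strictly below the upper threshold.\<close>
  have below: "snd (p $ i) < b2" if i: "\<alpha> i = 0" "fst (p $ i) < b1" for i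
  proof -
    define \<eta> where "\<eta> = min (b1 - fst (p $ i)) (r / 2)"
    have \<eta>: "\<eta> > 0" "\<eta> \<le> b1 - fst (p $ i)" "\<eta> < r" using i(2) r(1) by (auto simp: \<eta>_def)
    define x where "x = p + axis i (\<eta>, 0)"
    have "x \<in> ?S" using pS \<eta>
      by (auto simp: x_def state_space_def state_box_def axis_def mem_Times_iff)
    moreover have "dist x p < r" using \<eta> by (simp add: x_def dist_norm norm_eq_sqrt_inner inner_axis_axis)
    ultimately have "x \<in> ?R" by (rule r(2))
    then have "fst (x $ i) \<le> \<theta> + \<delta>" using i(1) by (simp add: regime_def)
    then have less: "fst (p $ i) < \<theta> + \<delta>" using \<eta>(1) by (simp add: x_def axis_def)
    have "fst (p $ i) \<ge> \<theta>" using pR i(1) by (simp add: regime_def)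
    with less i(2) have "activation \<theta> \<delta> (fst (p $ i)) < activation \<theta> \<delta> b1"
      using pos(5) by (auto simp: activation_def field_simps)
    moreover have "\<gamma>2 * snd (p $ i) = V2 * activation \<theta> \<delta> (fst (p $ i))"
      using eq by (simp add: network_def vec_eq_iff prod_eq_iff)
    ultimately have "\<gamma>2 * snd (p $ i) < \<gamma>2 * b2"
      using corner(2) mult_strict_left_mono[OF _ pos(4)] by (metis order_less_le_trans)
    then show ?thesis using pos(2) by simp
  qed

  define \<kappa> where "\<kappa> = sqrt (V1 * V2 / \<delta>)"
  have \<kappa>: "\<kappa> > 0" "\<kappa>\<^sup>2 = V1 * V2 / \<delta>" using pos by (simp_all add: \<kappa>_def)
  define k where "k i = (if \<alpha> i = 0 then \<kappa> else 0)" for i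
  have "\<gamma>1 * real CARD('n) < \<gamma>1 * (V1 * V2 / (\<gamma>1 * \<gamma>2 * \<delta>))"
    using gain pos(1) by (rule mult_strict_left_mono)
  also have "\<dots> = (k l)\<^sup>2 / \<gamma>2" using pos by (simp add: k_def \<alpha>(2) \<kappa>(2))
  also have "\<dots> \<le> (\<Sum>i\<in>UNIV. (k i)\<^sup>2 / \<gamma>2)"
    using pos(2) by (intro member_le_sum) auto
  finally have k_gain: "(\<Sum>i\<in>UNIV. (k i)\<^sup>2 / \<gamma>2) > \<gamma>1 * real CARD('n)" .
  have k_nonneg: "k i \<ge> 0" for i using \<kappa>(1) by (simp add: k_def)
  obtain \<mu> u where \<mu>: "\<mu> > 0" and u: "u \<noteq> 0" "\<And>i. fst (u $ i) \<ge> 0" "\<And>i. snd (u $ i) \<ge> 0"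
    and mode: "symmetrised \<gamma>1 \<gamma>2 k a u = \<mu> *\<^sub>R u"
    by (rule nonnegative_growing_mode[where a = a, OF a k_nonneg pos(2) k_gain]) (rule that)
  have mode1: "- \<gamma>1 * fst (u $ i) + k i * snd (u $ i)
      + (\<Sum>j\<in>UNIV. a i j * (fst (u $ j) - fst (u $ i))) = \<mu> * fst (u $ i)"
    and mode2: "- \<gamma>2 * snd (u $ i) + k i * fst (u $ i) = \<mu> * snd (u $ i)" for i
    using mode by (simp_all add: symmetrised_def vec_eq_iff prod_eq_iff)
  have inert: "snd (u $ i) = 0" if "\<alpha> i \<noteq> 0" for i
  proof -
    have "(\<mu> + \<gamma>2) * snd (u $ i) = 0" using mode2[of i] that by (simp add: k_def algebra_simps)
    then show ?thesis using \<mu> pos(2) by simp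
  qed

  \<comment> \<open>The two orientations never meet across an edge, so the signs pass through the coupling.\<close>
  define s where "s i = (if fst (p $ i) = b1 then -1 else 1 :: real)" for i
  have s_const: "a i j * (s j * t - s i * t') = s i * (a i j * (t - t'))" for i j t t'
  proof (cases "a i j = 0")
    case False
    then have "a j i \<noteq> 0" using a(1)[of i j] by simp
    then have "s i = s j" using face(2)[of i j] face(2)[of j i] False by (auto simp: s_def)
    then show ?thesis by (simp add: algebra_simps)
  qed simp
  \<comment> \<open>The factor \<open>\<kappa> / V1\<close> undoes the rescaling of the second components.\<close>
  define w where "w = (\<chi> i. (s i * fst (u $ i), s i * (\<kappa> / V1 * snd (u $ i))))"
  have w0: "w \<noteq> 0"
  proof
    assume "w = 0"
    then have "s i * fst (u $ i) = 0 \<and> s i * (\<kappa> / V1 * snd (u $ i)) = 0" for i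
      by (simp add: w_def vec_eq_iff prod_eq_iff del: mult_eq_0_iff)
    moreover have "s i \<noteq> 0" for i by (simp add: s_def)
    ultimately have "u = 0" using \<kappa>(1) pos(3) by (simp add: vec_eq_iff prod_eq_iff)
    with u(1) show False by simp
  qed
  have w_mode: "linearised \<gamma>1 \<gamma>2 V1 (\<lambda>i. if \<alpha> i = 0 then V2 / \<delta> else 0) a w = \<mu> *\<^sub>R w"
  proof -
    have "- \<gamma>1 * (s i * fst (u $ i)) + V1 * (s i * (\<kappa> / V1 * snd (u $ i)))
        + (\<Sum>j\<in>UNIV. a i j * (s j * fst (u $ j) - s i * fst (u $ i))) = \<mu> * (s i * fst (u $ i))" for i
    proof -
      define L where "L = (\<Sum>j\<in>UNIV. a i j * (fst (u $ j) - fst (u $ i)))"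
      have L: "(\<Sum>j\<in>UNIV. a i j * (s j * fst (u $ j) - s i * fst (u $ i))) = s i * L"
        by (simp only: s_const L_def sum_distrib_left)
      have gain_eq: "\<kappa> * snd (u $ i) = k i * snd (u $ i)" using inert[of i] by (auto simp: k_def)
      have "- \<gamma>1 * fst (u $ i) + \<kappa> * snd (u $ i) + L = \<mu> * fst (u $ i)"
        unfolding gain_eq L_def by (rule mode1)
      then have "s i * (- \<gamma>1 * fst (u $ i) + \<kappa> * snd (u $ i) + L) = s i * (\<mu> * fst (u $ i))"
        by (rule arg_cong)
      moreover have "V1 * (s i * (\<kappa> / V1 * snd (u $ i))) = s i * (\<kappa> * snd (u $ i))"
        using pos(3) by simp
      ultimately show ?thesis unfolding L by (simp add: algebra_simps)
    qed
    moreover have "- \<gamma>2 * (s i * (\<kappa> / V1 * snd (u $ i)))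
        + (if \<alpha> i = 0 then V2 / \<delta> else 0) * (s i * fst (u $ i))
        = \<mu> * (s i * (\<kappa> / V1 * snd (u $ i)))" for i
    proof -
      have slope: "(if \<alpha> i = 0 then V2 / \<delta> else 0) = \<kappa> / V1 * k i"
        using \<kappa>(2) pos(3) by (simp add: k_def power2_eq_square)
      have "s i * (\<kappa> / V1) * (- \<gamma>2 * snd (u $ i) + k i * fst (u $ i))
          = s i * (\<kappa> / V1) * (\<mu> * snd (u $ i))" by (simp only: mode2)
      then show ?thesis unfolding slope by (simp add: algebra_simps)
    qed
    ultimately show ?thesis by (simp add: linearised_def w_def vec_eq_iff prod_eq_iff)
  qed

  have "\<forall>\<^sub>F \<tau> in at_right 0. (p + \<tau> *\<^sub>R w) $ i \<in> state_box b1 b2" for i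
  proof -
    have "\<forall>\<^sub>F \<tau> in at_right 0. fst (p $ i) + \<tau> * fst (w $ i) \<in> {0..b1}"
      by (rule interval_ray) (use box[of i] u(2)[of i] pos in \<open>auto simp: w_def s_def\<close>)
    moreover have "\<forall>\<^sub>F \<tau> in at_right 0. snd (p $ i) + \<tau> * snd (w $ i) \<in> {0..b2}"
    proof (rule interval_ray)
      show "snd (p $ i) \<in> {0..b2}" using box by simp
      have "\<kappa> / V1 * snd (u $ i) \<ge> 0" using \<kappa>(1) pos(3) u(3) by simp
      then show "0 \<le> snd (w $ i) \<and> (snd (p $ i) < b2 \<or> snd (w $ i) = 0)
          \<or> snd (w $ i) \<le> 0 \<and> 0 < snd (p $ i)"
        using face(1)[of i] below[of i] inert[of i] box(2)[of i] pos(7)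
        by (cases "\<alpha> i = 0") (auto simp: w_def s_def)
    qed
    ultimately show ?thesis
      by eventually_elim (simp add: state_box_def mem_Times_iff)
  qed
  then have "\<forall>\<^sub>F \<tau> in at_right 0. \<forall>i. (p + \<tau> *\<^sub>R w) $ i \<in> state_box b1 b2"
    by (rule eventually_all_finite)
  moreover have "((\<lambda>\<tau>. dist (p + \<tau> *\<^sub>R w) p) \<longlongrightarrow> 0) (at_right 0)"
    by (rule tendsto_eq_intros refl | simp)+
  from order_tendstoD(2)[OF this r(1)]
  have "\<forall>\<^sub>F \<tau> in at_right 0. dist (p + \<tau> *\<^sub>R w) p < r" .
  ultimately have "\<forall>\<^sub>F \<tau> in at_right 0. p + \<tau> *\<^sub>R w \<in> ?R"
    by eventually_elim (simp add: r(2) state_space_def)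
  then obtain e where e: "e > 0" "\<And>\<tau>. 0 < \<tau> \<Longrightarrow> \<tau> < e \<Longrightarrow> p + \<tau> *\<^sub>R w \<in> ?R"
    unfolding eventually_at_right_field by auto
  show ?thesis
  proof (rule invariant_ray_imp_unstable[OF \<mu> w0])
    show "e / 2 > 0" using e(1) by simp
    fix \<tau> :: real assume "0 < \<tau>" "\<tau> \<le> e / 2"
    then have R: "p + \<tau> *\<^sub>R w \<in> ?R" using e by simp
    have "network \<gamma>1 \<gamma>2 V1 V2 \<theta> \<delta> a (p + \<tau> *\<^sub>R w) = (\<mu> * \<tau>) *\<^sub>R w"
      using network_eq_linearised[OF activation_affine_on_regime[OF R pR \<alpha>(1) pos(5)]]
      by (simp add: eq linearised_scaleR w_mode mult.commute)
    then show "p + \<tau> *\<^sub>R w \<in> ?S \<and> network \<gamma>1 \<gamma>2 V1 V2 \<theta> \<delta> a (p + \<tau> *\<^sub>R w) = (\<mu> * \<tau>) *\<^sub>R w"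
      using R by (simp add: regime_def)
  qed
qed

section \<open>Stability of network equilibria\<close>

theorem propositionV1:
  fixes \<gamma>1 \<gamma>2 V1 V2 \<theta> \<delta> b1 b2 :: real
    and a :: "'n::finite \<Rightarrow> 'n \<Rightarrow> real"
  assumes "\<gamma>1 > 0" and "\<gamma>2 > 0" and "V1 > 0" and "V2 > 0" and "\<theta> > 0" and "\<delta> > 0"
    and "V1 * V2 / (\<delta> * \<gamma>1 * \<gamma>2) > 1 + \<theta> / \<delta>"
    and "\<And>i j. a i j = a j i" and "\<And>i j. a i j \<ge> 0"
    and "b1 > 0" and "b2 > 0"
    and "forward_invariant (compartment \<gamma>1 \<gamma>2 V1 V2 \<theta> \<delta>) (state_box b1 b2)"
  shows "(\<forall>\<alpha>\<in>dom_indices. saturated_index \<alpha> \<longrightarrow>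
            (\<forall>p\<in>regime b1 b2 \<theta> \<delta> \<alpha>.
               equilibrium (network \<gamma>1 \<gamma>2 V1 V2 \<theta> \<delta> a) (state_space b1 b2) p \<longrightarrow>
                 (\<forall>q\<in>regime b1 b2 \<theta> \<delta> \<alpha>.
                    equilibrium (network \<gamma>1 \<gamma>2 V1 V2 \<theta> \<delta> a) (state_space b1 b2) q \<longrightarrow> q = p) \<and>
                 locally_asymptotically_stable
                   (network \<gamma>1 \<gamma>2 V1 V2 \<theta> \<delta> a) (state_space b1 b2) p)) \<and>
         (V1 * V2 / (\<gamma>1 * \<gamma>2 * \<delta>) > real CARD('n) \<longrightarrow>
          (\<forall>\<alpha>\<in>dom_indices. linear_index \<alpha> \<or> mixed_index \<alpha> \<longrightarrow>
            (\<forall>p\<in>top_of_set (state_space b1 b2) interior_of regime b1 b2 \<theta> \<delta> \<alpha>.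
               equilibrium (network \<gamma>1 \<gamma>2 V1 V2 \<theta> \<delta> a) (state_space b1 b2) p \<longrightarrow>
                 \<not> lyapunov_stable (network \<gamma>1 \<gamma>2 V1 V2 \<theta> \<delta> a) (state_space b1 b2) p)))"
proof (intro conjI ballI impI)
  fix \<alpha> :: "'n \<Rightarrow> int" and p
  assume \<alpha>: "\<alpha> \<in> dom_indices" "saturated_index \<alpha>" and p: "p \<in> regime b1 b2 \<theta> \<delta> \<alpha>"
    and "equilibrium (network \<gamma>1 \<gamma>2 V1 V2 \<theta> \<delta> a) (state_space b1 b2) p"
  then have eq: "network \<gamma>1 \<gamma>2 V1 V2 \<theta> \<delta> a p = 0" by (simp add: equilibrium_def)
  have nz: "\<alpha> i = -1 \<or> \<alpha> i = 1" for i using \<alpha>(2) by (auto simp: saturated_index_def)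
  show "q = p" if q: "q \<in> regime b1 b2 \<theta> \<delta> \<alpha>"
    and "equilibrium (network \<gamma>1 \<gamma>2 V1 V2 \<theta> \<delta> a) (state_space b1 b2) q" for q
  proof -
    have "network \<gamma>1 \<gamma>2 V1 V2 \<theta> \<delta> a q = 0" using that(2) by (simp add: equilibrium_def)
    moreover have "(if \<alpha> i = 0 then V2 / \<delta> else 0) = 0" for i using nz[of i] by auto
    ultimately have "linearised \<gamma>1 \<gamma>2 V1 (\<lambda>_. 0) a (q - p) = 0"
      using network_eq_linearised[OF activation_affine_on_regime[OF q p \<alpha>(1) \<open>\<delta> > 0\<close>],
          of \<gamma>1 \<gamma>2 V1 V2 a] eq by simp
    then have "q - p = 0" by (rule saturated_linearisation_injective[where a = a, OF assms(1,2,8,9)])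
    then show ?thesis by simp
  qed
  have "fst (p $ i) < \<theta> \<or> fst (p $ i) > \<theta> + \<delta>" for i
    using p nz[of i] by (auto simp: regime_def)
  then obtain r where r: "r > 0" "\<And>x i. dist x p < r \<Longrightarrow>
      activation \<theta> \<delta> (fst (x $ i)) = activation \<theta> \<delta> (fst (p $ i))"
    using saturated_activation_locally_constant[OF _ \<open>\<delta> > 0\<close>, of p \<theta>] by blast
  show "locally_asymptotically_stable (network \<gamma>1 \<gamma>2 V1 V2 \<theta> \<delta> a) (state_space b1 b2) p"
    by (rule locally_constant_activation_imp_stable[where a = a, OF assms(1-3,8,9) eq r])
next
  fix \<alpha> :: "'n \<Rightarrow> int" and p
  assume gain: "V1 * V2 / (\<gamma>1 * \<gamma>2 * \<delta>) > real CARD('n)"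
    and \<alpha>: "\<alpha> \<in> dom_indices" "linear_index \<alpha> \<or> mixed_index \<alpha>"
    and p: "p \<in> top_of_set (state_space b1 b2) interior_of regime b1 b2 \<theta> \<delta> \<alpha>"
    and "equilibrium (network \<gamma>1 \<gamma>2 V1 V2 \<theta> \<delta> a) (state_space b1 b2) p"
  then have eq: "network \<gamma>1 \<gamma>2 V1 V2 \<theta> \<delta> a p = 0" by (simp add: equilibrium_def)
  have "\<not> saturated_index \<alpha>"
    using \<alpha>(2) by (auto simp: linear_index_def mixed_index_def saturated_index_def)
  then obtain l where "\<alpha> l = 0"
    using \<alpha>(1) unfolding saturated_index_def dom_indices_def by blast
  then show "\<not> lyapunov_stable (network \<gamma>1 \<gamma>2 V1 V2 \<theta> \<delta> a) (state_space b1 b2) p"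
    by (intro nonsaturated_equilibrium_unstable[where a = a, OF assms(1-4,6,10,11,8,9)
          invariant_box_corner[OF assms(12,6,10,11)] gain \<alpha>(1) _ p eq])
qed

end
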